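(* Let $(N,V)$ be the set-valued cooperative game associated with a pure exchange economy with fractional linear utility functions, as defined in the context. Then $(N,V)$ is balanced: for every balanced collection $\mathcal{B}$ of coalitions with balancing weights $\gamma(S)>0$, $S\in\mathcal{B}$, $$\sum_{S\in\mathcal{B}}\gamma(S)V(S)\subseteq V(N).$$
   Context: Consider a pure exchange economy with agents $N=\{1,\dots,n\}$ and commodity space $\mathbb{R}^m$; coalitions are nonempty subsets of $N$. Agent $i$ has initial endowment $e_i=(e_i^1,\dots,e_i^m)\in\mathbb{R}^m_+$. Let $p=mn$. A vector of bundles is written $x=(x_1,\dots,x_p)\in\mathbb{R}^p_+$, where agent $i$'s bundle is $x_{[i]}=(x_{(i-1)m+1},\dots,x_{im})$. The utility of agent $i$ is $U_i(x)=\frac{N_i(x)}{D_i(x)}$ with $N_i(x)=c_i\cdot x_{[i]}+c_{i0}$, $D_i(x)=d_i\cdot x_{[i]}+d_{i0}$, where $c_i,d_i\in\mathbb{R}^m$, $c_{i0},d_{i0}\in\mathbb{R}$. For a coalition $S$, let $b(S)=(b_1(S),\dots,b_m(S))^T$ with $b_i(S)=\sum_{j\in S}e_j^i$, and let $A(S)=(a_{ij}(S))\in\mathbb{R}^{m\times p}$ with $a_{ij}(S)=1$ if $j=(k-1)m+i$ for some $k\in S$ and $a_{ij}(S)=0$ otherwise; so $A(S)x=\sum_{k\in S}x_{[k]}$. Coalition $S$ faces the problem of maximizing $(U_1(x),\dots,U_n(x))$ over $D_S=\{x\in\mathbb{R}^p_+: A(S)x\le b(S),\ A(N)x\le b(N)\}$.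 It is assumed that $D_i(x)>0$ for every coalition $S$, every $x\in D_S$ and every $i\in N$. The problem is transformed into a multiobjective linear problem with feasible set $$T_S=\{(t,y)\in\mathbb{R}_+\times\mathbb{R}^p_+:\ d_i\cdot y_{[i]}+d_{i0}t\le 1\ (i=1,\dots,n),\ A(S)y-t\,b(S)\le 0,\ A(N)y-t\,b(N)\le 0\}$$ and image in objective space $$\widehat T_S=\{(c_1\cdot y_{[1]}+c_{10}t,\dots,c_n\cdot y_{[n]}+c_{n0}t):(t,y)\in T_S\}\subseteq\mathbb{R}^n,$$ where $y_{[i]}=(y_{(i-1)m+1},\dots,y_{im})$. For $Z\subseteq\mathbb{R}^n$, $\mathrm{Max}\,Z$ denotes the set of Pareto maximal elements of $Z$, i.e. those $z\in Z$ for which there is no $z'\in Z$ with $z'\ge z$ componentwise and $z'\neq z$. A collection $\mathcal{B}$ of coalitions is balanced if there are weights $\gamma(S)>0$, $S\in\mathcal{B}$ (balancing weights), such that $\sum_{S\in\mathcal{B},\,i\in S}\gamma(S)=1$ for each $i\in N$. Let $\gamma^*$ be the maximum of $\sum_{S\in\mathcal{B}}\gamma(S)$ over all balanced collections (and their balancing weights), and fix $\gamma>\max(\gamma^*,n)$. The game assigns to each coalition a subset of $\mathbb{R}^n$: $V(S)=(\mathrm{Max}\,\widehat T_S-\mathbb{R}^n_+)\cap\mathbb{R}^n_+$ for nonempty $S\subsetneq N$, and $V(N)=(\mathrm{Max}(\gamma\widehat T_N)-\mathbb{R}^n_+)\cap\mathbb{R}^n_+$ (and $V(\emptyset)=\{0\}$).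 Sums and scalar multiples of sets are in the Minkowski sense. *)

theory Defs
  imports "HOL-Analysis.Analysis" "HOL-Library.Set_Algebras"
begin

(* The agents are the elements of the finite type 'n and the commodities those of the
   finite type 'm, so N = UNIV, n = CARD('n) and m = CARD('m).
   R^p with p = m n is real^('n * 'm): coordinate (k, i) is the amount of commodity i
   held by agent k, that is the coordinate with number (k - 1) m + i.
   The order on vectors is the componentwise one. *)

record ('n, 'm :: finite) economy =
  endow :: "'n \<Rightarrow> real ^ 'm"
  num_coeff :: "'n \<Rightarrow> real ^ 'm"
  num_const :: "'n \<Rightarrow> real"
  den_coeff :: "'n \<Rightarrow> real ^ 'm"
  den_const :: "'n \<Rightarrow> real"

definition agent_bundle :: "real ^ ('n::finite \<times> 'm::finite) \<Rightarrow> 'n \<Rightarrow> real ^ 'm" where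
  "agent_bundle x k = (\<chi> i. x $ (k, i))"

definition numer :: "('n::finite, 'm::finite) economy \<Rightarrow> 'n \<Rightarrow> real ^ ('n \<times> 'm) \<Rightarrow> real" where
  "numer E k x = num_coeff E k \<bullet> agent_bundle x k + num_const E k"

definition denom :: "('n::finite, 'm::finite) economy \<Rightarrow> 'n \<Rightarrow> real ^ ('n \<times> 'm) \<Rightarrow> real" where
  "denom E k x = den_coeff E k \<bullet> agent_bundle x k + den_const E k"

definition utility :: "('n::finite, 'm::finite) economy \<Rightarrow> 'n \<Rightarrow> real ^ ('n \<times> 'm) \<Rightarrow> real" where
  "utility E k x = numer E k x / denom E k x"

definition coal_endow :: "('n::finite, 'm::finite) economy \<Rightarrow> 'n set \<Rightarrow> real ^ 'm" where
  "coal_endow E S = (\<Sum>k\<in>S. endow E k)"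

definition coal_matrix :: "'n::finite set \<Rightarrow> real ^ ('n \<times> 'm::finite) ^ 'm" where
  "coal_matrix S = (\<chi> i. \<chi> j. if fst j \<in> S \<and> snd j = i then 1 else 0)"

lemma coal_matrix_mult: "coal_matrix S *v x = (\<Sum>k\<in>S. agent_bundle x k)"
proof -
  have "(\<Sum>j\<in>UNIV. (if fst j \<in> S \<and> snd j = i then 1 else 0) * x $ j) = (\<Sum>k\<in>S. x $ (k, i))"
    for i
  proof -
    have "(\<Sum>j\<in>UNIV. (if fst j \<in> S \<and> snd j = i then 1 else 0) * x $ j)
        = (\<Sum>j\<in>(\<lambda>k. (k, i)) ` S. x $ j)"
      by (rule sum.mono_neutral_cong_right) (auto simp: image_iff)
    also have "\<dots> = (\<Sum>k\<in>S. x $ (k, i))"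
      by (subst sum.reindex) (auto simp: inj_on_def)
    finally show ?thesis .
  qed
  then show ?thesis
    by (simp add: vec_eq_iff matrix_vector_mult_def coal_matrix_def agent_bundle_def)
qed

text \<open>The sets \<open>D\<^sub>S\<close>, \<open>T\<^sub>S\<close> and the image of \<open>T\<^sub>S\<close> in objective space.\<close>

definition feasible :: "('n::finite, 'm::finite) economy \<Rightarrow> 'n set \<Rightarrow> (real ^ ('n \<times> 'm)) set" where
  "feasible E S = {x. 0 \<le> x \<and> coal_matrix S *v x \<le> coal_endow E S
                         \<and> coal_matrix UNIV *v x \<le> coal_endow E UNIV}"

definition lin_feasible ::
    "('n::finite, 'm::finite) economy \<Rightarrow> 'n set \<Rightarrow> (real \<times> (real ^ ('n \<times> 'm))) set" where
  "lin_feasible E S = {(t, y). 0 \<le> t \<and> 0 \<le> y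
      \<and> (\<forall>i. den_coeff E i \<bullet> agent_bundle y i + den_const E i * t \<le> 1)
      \<and> coal_matrix S *v y - t *\<^sub>R coal_endow E S \<le> 0
      \<and> coal_matrix UNIV *v y - t *\<^sub>R coal_endow E UNIV \<le> 0}"

definition lin_image :: "('n::finite, 'm::finite) economy \<Rightarrow> 'n set \<Rightarrow> (real ^ 'n) set" where
  "lin_image E S =
     (\<lambda>(t, y). \<chi> i. num_coeff E i \<bullet> agent_bundle y i + num_const E i * t) ` lin_feasible E S"

definition pareto_max :: "(real ^ 'n::finite) set \<Rightarrow> (real ^ 'n) set" where
  "pareto_max Z = {z \<in> Z. \<not> (\<exists>z'\<in>Z. z \<le> z' \<and> z' \<noteq> z)}"

(* The set (Z - R^n_+) \<inter> R^n_+, with a Minkowski difference; the library's A - B on sets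
   is the set-theoretic difference. *)

definition nonneg_down :: "(real ^ 'n::finite) set \<Rightarrow> (real ^ 'n) set" where
  "nonneg_down Z = {z - r | z r. z \<in> Z \<and> 0 \<le> r} \<inter> {v. 0 \<le> v}"

definition game :: "('n::finite, 'm::finite) economy \<Rightarrow> real \<Rightarrow> 'n set \<Rightarrow> (real ^ 'n) set" where
  "game E \<gamma> S =
     (if S = {} then {0}
      else if S = UNIV then nonneg_down (pareto_max ((*\<^sub>R) \<gamma> ` lin_image E UNIV))
      else nonneg_down (pareto_max (lin_image E S)))"

definition balancing_weights :: "'n::finite set \<Rightarrow> 'n set set \<Rightarrow> ('n set \<Rightarrow> real) \<Rightarrow> bool" where
  "balancing_weights N \<B> w \<longleftrightarrow>
     (\<forall>S\<in>\<B>. S \<noteq> {} \<and> S \<subseteq> N \<and> 0 < w S) \<and>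
     (\<forall>i\<in>N. (\<Sum>S\<in>{S \<in> \<B>. i \<in> S}. w S) = 1)"

definition max_total_weight :: "'n::finite set \<Rightarrow> real" where
  "max_total_weight N = (GREATEST s. \<exists>\<B> w. balancing_weights N \<B> w \<and> s = (\<Sum>S\<in>\<B>. w S))"

text \<open>The maximum is attained, so it is not a junk value of \<open>Greatest\<close>.\<close>

lemma balancing_weights_sum_le:
  assumes "balancing_weights N \<B> w"
  shows "(\<Sum>S\<in>\<B>. w S) \<le> real (card N)"
proof -
  have "(\<Sum>S\<in>\<B>. w S) \<le> (\<Sum>S\<in>\<B>. \<Sum>i\<in>S. w S)"
  proof (rule sum_mono)
    fix S assume S: "S \<in> \<B>"
    then have "card S \<ge> 1" "0 < w S"
      using assms by (auto simp: balancing_weights_def Suc_le_eq card_gt_0_iff)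
    then show "w S \<le> (\<Sum>i\<in>S. w S)"
      using mult_right_mono[of 1 "real (card S)" "w S"] by simp
  qed
  also have "\<dots> = (\<Sum>S\<in>\<B>. \<Sum>i\<in>{i \<in> N. i \<in> S}. w S)"
  proof (rule sum.cong)
    fix S assume "S \<in> \<B>"
    then have "{i \<in> N. i \<in> S} = S" using assms by (auto simp: balancing_weights_def)
    then show "(\<Sum>i\<in>S. w S) = (\<Sum>i\<in>{i \<in> N. i \<in> S}. w S)" by simp
  qed simp
  also have "\<dots> = (\<Sum>i\<in>N. \<Sum>S\<in>{S \<in> \<B>. i \<in> S}. w S)"
    by (rule sum.swap_restrict) auto
  also have "\<dots> = real (card N)"
    using assms by (simp add: balancing_weights_def)
  finally show ?thesis .
qed

lemma max_total_weight_is_max: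
  "\<exists>\<B> w. balancing_weights N \<B> w \<and> max_total_weight N = (\<Sum>S\<in>\<B>. w S)"
  "balancing_weights N \<B> w \<Longrightarrow> (\<Sum>S\<in>\<B>. w S) \<le> max_total_weight N"
proof -
  let ?P = "\<lambda>s. \<exists>\<B> w. balancing_weights N \<B> w \<and> s = (\<Sum>S\<in>\<B>. w S)"
  have eq: "{S \<in> (\<lambda>i. {i}) ` N. i \<in> S} = {{i}}" if "i \<in> N" for i using that by auto
  have "balancing_weights N ((\<lambda>i. {i}) ` N) (\<lambda>_. 1)"
    by (auto simp: balancing_weights_def eq)
  moreover have "(\<Sum>S\<in>(\<lambda>i. {i}) ` N. 1::real) = real (card N)"
    by (simp add: card_image)
  ultimately have P: "?P (real (card N))" by metis
  have le: "s \<le> real (card N)" if "?P s" for s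
    using that balancing_weights_sum_le by blast
  have g: "max_total_weight N = real (card N)"
    unfolding max_total_weight_def
    by (rule Greatest_equality[where P = ?P]) (fact P, fact le)
  show "?P (max_total_weight N)" unfolding g by (rule P)
  show "balancing_weights N \<B> w \<Longrightarrow> (\<Sum>S\<in>\<B>. w S) \<le> max_total_weight N"
    unfolding g by (rule balancing_weights_sum_le)
qed

end

theory Submission
  imports Defs
begin

text \<open>Each \<open>T\<^sub>S\<close> is contained in \<open>T\<^sub>N\<close>, whose image is convex and contains \<open>0\<close>, so a sum of
  payoffs with weights \<open>w S\<close> is dominated by a point of the scaled image of \<open>T\<^sub>N\<close> as soon as the
  weights, with \<open>w N\<close> multiplied by \<open>\<gamma>\<close>, add up to at most \<open>\<gamma>\<close>. Since \<open>\<gamma> \<ge> n\<close>, this follows from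
  \<open>\<Sum>S. w S * card S = n\<close>. Positivity of the denominators on \<open>D\<^sub>N\<close> makes \<open>T\<^sub>N\<close> compact, and in a
  compact set every point is dominated by a Pareto maximal one.\<close>

section \<open>Bundles, Pareto maxima and convex combinations\<close>

lemma agent_bundle_add: "agent_bundle (x + y) k = agent_bundle x k + agent_bundle y k"
  by (simp add: agent_bundle_def vec_eq_iff)

lemma agent_bundle_scaleR: "agent_bundle (c *\<^sub>R x) k = c *\<^sub>R agent_bundle x k"
  by (simp add: agent_bundle_def vec_eq_iff)

lemma agent_bundle_zero: "agent_bundle 0 k = 0"
  by (simp add: agent_bundle_def vec_eq_iff)

lemma continuous_on_agent_bundle [continuous_intros]:
  "continuous_on A f \<Longrightarrow> continuous_on A (\<lambda>x. agent_bundle (f x) k)"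
  unfolding agent_bundle_def by (intro continuous_intros)

lemma closed_Collect_le_vec:
  fixes f g :: "'a::topological_space \<Rightarrow> real ^ 'n"
  assumes "continuous_on UNIV f" "continuous_on UNIV g"
  shows "closed {x. f x \<le> g x}"
  unfolding less_eq_vec_def
  by (intro closed_Collect_all closed_Collect_le continuous_intros assms)

text \<open>A point maximizing the coordinate sum over the part of \<open>Z\<close> above
  \<open>z\<close> is Pareto maximal: a different point of \<open>Z\<close> above it would still lie
  above \<open>z\<close> and have a strictly larger sum.\<close>

lemma pareto_max_dominates:
  assumes "compact Z" "z \<in> Z"
  shows "\<exists>z'\<in>pareto_max Z. z \<le> z'"
proof -
  let ?W = "Z \<inter> {z'. z \<le> z'}"
  have "compact ?W"
    by (intro compact_Int_closed assms closed_Collect_le_vec continuous_intros)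
  moreover have "z \<in> ?W" using assms by simp
  moreover have "continuous_on ?W (\<lambda>v. \<Sum>i\<in>UNIV. v $ i)" by (intro continuous_intros)
  ultimately obtain m where m: "m \<in> ?W" "\<forall>v\<in>?W. (\<Sum>i\<in>UNIV. v $ i) \<le> (\<Sum>i\<in>UNIV. m $ i)"
    using continuous_attains_sup[of ?W] by blast
  have "v = m" if v: "v \<in> Z" "m \<le> v" for v
  proof (rule ccontr)
    assume "v \<noteq> m"
    then obtain i where "v $ i \<noteq> m $ i" by (auto simp: vec_eq_iff)
    with v(2) have "m $ i < v $ i" by (simp add: less_eq_vec_def order_less_le)
    with v(2) have "(\<Sum>i\<in>UNIV. m $ i) < (\<Sum>i\<in>UNIV. v $ i)"
      by (intro sum_strict_mono_ex1) (auto simp: less_eq_vec_def)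
    moreover have "v \<in> ?W" using m(1) v by auto
    ultimately show False using m(2) by (meson leD)
  qed
  with m(1) show ?thesis by (auto simp: pareto_max_def)
qed

text \<open>The missing weight \<open>1 - sum a I\<close> can be placed on \<open>0\<close>. The
  weights are first normalized to total 1, which is why a zero total is a separate case.\<close>

lemma convex_sum_subunit:
  fixes p :: "'i \<Rightarrow> 'a::real_vector"
  assumes "convex C" "0 \<in> C" "finite I"
    and "\<And>i. i \<in> I \<Longrightarrow> 0 \<le> a i" "sum a I \<le> 1" "\<And>i. i \<in> I \<Longrightarrow> p i \<in> C"
  shows "(\<Sum>i\<in>I. a i *\<^sub>R p i) \<in> C"
proof (cases "sum a I = 0")
  case True
  then have "\<forall>i\<in>I. a i = 0" using assms sum_nonneg_eq_0_iff by blast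
  then show ?thesis using assms(2) by simp
next
  case False
  let ?s = "sum a I"
  have s: "0 < ?s" using False sum_nonneg[of I a] assms(4) by fastforce
  have "(\<Sum>i\<in>I. (a i / ?s) *\<^sub>R p i) \<in> C"
    using s assms by (intro convex_sum) (auto simp: sum_divide_distrib[symmetric])
  then have "?s *\<^sub>R (\<Sum>i\<in>I. (a i / ?s) *\<^sub>R p i) + (1 - ?s) *\<^sub>R 0 \<in> C"
    using s assms by (intro convexD) auto
  then show ?thesis using s by (simp add: scaleR_sum_right)
qed

section \<open>Compactness and convexity of the feasible sets\<close>

text \<open>Since all holdings are nonnegative, one agent's holding is at most the total, which
  \<open>b\<close> bounds.\<close>

lemma component_le_coal_endow:
  assumes "0 \<le> y" "coal_matrix UNIV *v y \<le> b"
  shows "y $ (k, i) \<le> b $ i"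
proof -
  have "y $ (k, i) \<le> (\<Sum>k\<in>UNIV. y $ (k, i))"
    using assms(1) by (intro member_le_sum) (auto simp: less_eq_vec_def)
  also have "\<dots> \<le> b $ i"
    using assms(2) by (simp add: coal_matrix_mult agent_bundle_def less_eq_vec_def)
  finally show ?thesis .
qed

lemma compact_feasible: "compact (feasible E UNIV)"
proof -
  have "feasible E UNIV \<subseteq> cbox 0 (\<chi> j. coal_endow E UNIV $ snd j)"
    by (auto simp: feasible_def mem_box_cart component_le_coal_endow)
       (auto simp: less_eq_vec_def)
  then have "bounded (feasible E UNIV)" using bounded_cbox bounded_subset by blast
  moreover have "closed (feasible E UNIV)"
    unfolding feasible_def coal_matrix_mult
    by (intro closed_Collect_conj closed_Collect_le_vec continuous_intros)
  ultimately show ?thesis by (simp add: compact_eq_bounded_closed)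
qed

lemma closed_lin_feasible: "closed (lin_feasible E S)"
  unfolding lin_feasible_def coal_matrix_mult case_prod_beta
  by (intro closed_Collect_conj closed_Collect_all closed_Collect_le closed_Collect_le_vec
        continuous_intros)

text \<open>Every constraint is a linear inequality in the pair \<open>(t, y)\<close>, with a
  right-hand side preserved by convex combinations.\<close>

lemma convex_lin_feasible: "convex (lin_feasible E S)"
proof (rule convexI)
  fix p q :: "real \<times> (real ^ ('a \<times> 'b))" and u v :: real
  assume "p \<in> lin_feasible E S" "q \<in> lin_feasible E S" and uv: "0 \<le> u" "0 \<le> v" "u + v = 1"
  then obtain t y s x where pq: "p = (t, y)" "q = (s, x)"
    and p: "(t, y) \<in> lin_feasible E S" and q: "(s, x) \<in> lin_feasible E S"
    by (metis surj_pair)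
  have comb: "u * a + v * b \<le> c" if "a \<le> c" "b \<le> c" for a b c :: real
    using convex_bound_le[OF that uv] .
  have den: "den_coeff E i \<bullet> agent_bundle (u *\<^sub>R y + v *\<^sub>R x) i + den_const E i * (u * t + v * s) \<le> 1"
    for i
  proof -
    have "den_coeff E i \<bullet> agent_bundle (u *\<^sub>R y + v *\<^sub>R x) i + den_const E i * (u * t + v * s)
      = u * (den_coeff E i \<bullet> agent_bundle y i + den_const E i * t)
        + v * (den_coeff E i \<bullet> agent_bundle x i + den_const E i * s)"
      by (simp add: agent_bundle_add agent_bundle_scaleR inner_add_right algebra_simps)
    also have "\<dots> \<le> 1" using p q by (intro comb) (auto simp: lin_feasible_def)
    finally show ?thesis .
  qed
  have mat: "coal_matrix R *v (u *\<^sub>R y + v *\<^sub>R x) - (u * t + v * s) *\<^sub>R b \<le> 0"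
    if "coal_matrix R *v y - t *\<^sub>R b \<le> 0" "coal_matrix R *v x - s *\<^sub>R b \<le> 0" for R and b :: "real ^ 'b"
  proof -
    have "coal_matrix R *v (u *\<^sub>R y + v *\<^sub>R x) - (u * t + v * s) *\<^sub>R b
      = u *\<^sub>R (coal_matrix R *v y - t *\<^sub>R b) + v *\<^sub>R (coal_matrix R *v x - s *\<^sub>R b)"
      by (simp add: matrix_vector_right_distrib matrix_vector_mult_scaleR algebra_simps)
    then show ?thesis using that uv comb[of _ 0] by (simp add: less_eq_vec_def)
  qed
  show "u *\<^sub>R p + v *\<^sub>R q \<in> lin_feasible E S"
    using p q uv den mat by (auto simp: pq lin_feasible_def less_eq_vec_def)
qed

text \<open>Every \<open>lin_feasible E S\<close> already carries the constraint of the grand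
  coalition; only the constraint of \<open>S\<close> is dropped.\<close>

lemma lin_feasible_subset: "lin_feasible E S \<subseteq> lin_feasible E UNIV"
  by (auto simp: lin_feasible_def)

context
  fixes E :: "('n::finite, 'm::finite) economy"
  assumes endow_nonneg: "\<And>i. 0 \<le> endow E i"
    and denom_pos: "\<And>x i. x \<in> feasible E UNIV \<Longrightarrow> 0 < denom E i x"
begin

lemma zero_in_feasible: "0 \<in> feasible E UNIV"
  using endow_nonneg
  by (simp add: feasible_def coal_endow_def less_eq_vec_def sum_nonneg)

text \<open>The substitution \<open>y = t *\<^sub>R x\<close> undoes the linearization: for
  \<open>t > 0\<close> the vector \<open>y / t\<close> lies in the compact set
  \<open>feasible E UNIV\<close>, where a denominator has a positive minimum
  \<open>\<delta>\<close>, and this forces \<open>t \<le> 1 / \<delta>\<close>.\<close>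

lemma bounded_lin_feasible: "bounded (lin_feasible E UNIV)"
proof -
  \<comment> \<open>The denominator of a single, arbitrary agent is enough to bound
    \<open>t\<close>.\<close>
  fix i :: 'n
  have "continuous_on (feasible E UNIV) (denom E i)"
    unfolding denom_def by (intro continuous_intros)
  then obtain x0 where x0: "x0 \<in> feasible E UNIV"
    and min: "\<And>x. x \<in> feasible E UNIV \<Longrightarrow> denom E i x0 \<le> denom E i x"
    using continuous_attains_inf[OF compact_feasible] zero_in_feasible by blast
  define \<delta> where "\<delta> = denom E i x0"
  have \<delta>: "0 < \<delta>" using denom_pos[OF x0] by (simp add: \<delta>_def)
  let ?f = "\<lambda>(t::real, x). (t, t *\<^sub>R x)"
  let ?K = "{0..1/\<delta>} \<times> feasible E UNIV"
  have "lin_feasible E UNIV \<subseteq> ?f ` ?K"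
  proof
    fix p assume "p \<in> lin_feasible E UNIV"
    moreover obtain t y where p: "p = (t, y)" by fastforce
    ultimately have t: "0 \<le> t" and y: "0 \<le> y"
      and den: "den_coeff E i \<bullet> agent_bundle y i + den_const E i * t \<le> 1"
      and mat: "coal_matrix UNIV *v y \<le> t *\<^sub>R coal_endow E UNIV"
      by (auto simp: lin_feasible_def less_eq_vec_def)
    show "p \<in> ?f ` ?K"
    proof (cases "t = 0")
      case True
      then have "y $ j \<le> 0" for j
        using component_le_coal_endow[OF y mat, of "fst j" "snd j"] by simp
      then have "y = 0" using y by (auto simp: less_eq_vec_def vec_eq_iff intro: antisym)
      then show ?thesis using True p \<delta> zero_in_feasible by (auto intro!: image_eqI[of _ _ "(0, 0)"])
    next
      case False
      with t have t: "0 < t" by simp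
      let ?x = "(1/t) *\<^sub>R y"
      have x: "?x \<in> feasible E UNIV"
        using t y mat
        by (simp add: feasible_def matrix_vector_mult_scaleR less_eq_vec_def field_simps)
      \<comment> \<open>Multiplying the denominator at \<open>y / t\<close> by \<open>t\<close>
        gives exactly the left-hand side of the constraint \<open>den\<close>.\<close>
      have "t * \<delta> \<le> t * denom E i ?x" using min[OF x] t by (simp add: \<delta>_def)
      also have "\<dots> = den_coeff E i \<bullet> agent_bundle y i + den_const E i * t"
        using t by (simp add: denom_def agent_bundle_scaleR algebra_simps)
      finally have "t \<le> 1 / \<delta>" using den \<delta> by (simp add: field_simps)
      then show ?thesis using x t p by (auto intro!: image_eqI[of _ _ "(t, ?x)"])
    qed
  qed
  moreover have "compact (?f ` ?K)"
    unfolding case_prod_beta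
    by (intro compact_continuous_image compact_Times compact_feasible continuous_intros) simp
  ultimately show ?thesis using compact_imp_bounded bounded_subset by blast
qed

text \<open>Compactness and convexity pass through the linear objective map, and the origin is the
  image of \<open>(0, 0)\<close>.\<close>

lemma lin_image_props:
  shows compact_lin_image: "compact (lin_image E UNIV)"
    and convex_lin_image: "convex (lin_image E UNIV)"
    and zero_in_lin_image: "0 \<in> lin_image E UNIV"
proof -
  let ?L = "\<lambda>(t, y). \<chi> i. num_coeff E i \<bullet> agent_bundle y i + num_const E i * t"
  have "compact (lin_feasible E UNIV)"
    using bounded_lin_feasible closed_lin_feasible by (simp add: compact_eq_bounded_closed)
  then show "compact (lin_image E UNIV)"
    unfolding lin_image_def case_prod_beta
    by (intro compact_continuous_image continuous_intros)
  have "linear ?L"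
    by (rule linearI)
       (auto simp: vec_eq_iff agent_bundle_add agent_bundle_scaleR inner_add_right algebra_simps)
  then show "convex (lin_image E UNIV)"
    unfolding lin_image_def by (intro convex_linear_image convex_lin_feasible)
  have "(0, 0) \<in> lin_feasible E UNIV"
    by (simp add: lin_feasible_def agent_bundle_zero)
  then show "0 \<in> lin_image E UNIV"
    unfolding lin_image_def by (rule rev_image_eqI) (simp add: vec_eq_iff agent_bundle_zero)
qed

end

section \<open>Domination of payoffs and balancedness\<close>

text \<open>This bounds the payoffs of all coalitions by points of one convex set, the image for the
  grand coalition; the factor \<gamma> appears only for \<open>S = UNIV\<close>, where it is built
  into the game.\<close>

lemma game_dominated:
  assumes "S \<noteq> {}" "v \<in> game E \<gamma> S"
  shows "0 \<le> v \<and> (\<exists>u\<in>lin_image E UNIV. v \<le> (if S = UNIV then \<gamma> else 1) *\<^sub>R u)"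
proof -
  have sub: "lin_image E S \<subseteq> lin_image E UNIV"
    unfolding lin_image_def by (intro image_mono lin_feasible_subset)
  have dom: "0 \<le> v \<and> (\<exists>z\<in>Z. v \<le> z)" if "v \<in> nonneg_down (pareto_max Z)" for Z
  proof -
    from that obtain z r where "z \<in> Z" "0 \<le> r" "v = z - r" "0 \<le> v"
      unfolding nonneg_down_def pareto_max_def by blast
    then show ?thesis by (auto simp: less_eq_vec_def intro!: bexI[of _ z])
  qed
  show ?thesis
  proof (cases "S = UNIV")
    case True
    then have "v \<in> nonneg_down (pareto_max ((*\<^sub>R) \<gamma> ` lin_image E UNIV))"
      using assms by (simp add: game_def)
    from dom[OF this] True show ?thesis by auto
  next
    case False
    then have "v \<in> nonneg_down (pareto_max (lin_image E S))"
      using assms by (simp add: game_def)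
    from dom[OF this] False sub show ?thesis by auto
  qed
qed

text \<open>Double counting of pairs of a coalition and a member: each agent contributes total
  weight 1.\<close>

lemma balancing_weights_card:
  fixes \<B> :: "'n::finite set set"
  assumes "balancing_weights UNIV \<B> w"
  shows "(\<Sum>S\<in>\<B>. w S * real (card S)) = real CARD('n)"
proof -
  have "(\<Sum>S\<in>\<B>. w S * real (card S)) = (\<Sum>S\<in>\<B>. \<Sum>i\<in>{i\<in>UNIV. i \<in> S}. w S)"
    by (simp add: mult.commute)
  also have "\<dots> = (\<Sum>i\<in>UNIV. \<Sum>S\<in>{S \<in> \<B>. i \<in> S}. w S)"
    by (rule sum.swap_restrict) auto
  also have "\<dots> = real CARD('n)"
    using assms by (simp add: balancing_weights_def)
  finally show ?thesis .
qed

theorem theorem10: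
  fixes E :: "('n::finite, 'm::finite) economy"
    and \<gamma> :: real
    and \<B> :: "'n set set"
    and w :: "'n set \<Rightarrow> real"
  assumes endow_nonneg: "\<And>i. 0 \<le> endow E i"
    and denom_pos: "\<And>S x i. S \<noteq> {} \<Longrightarrow> x \<in> feasible E S \<Longrightarrow> 0 < denom E i x"
    and gamma: "\<gamma> > max (max_total_weight (UNIV :: 'n set)) (real CARD('n))"
    and balanced: "balancing_weights UNIV \<B> w"
  shows "(\<Sum>S\<in>\<B>. (*\<^sub>R) (w S) ` game E \<gamma> S) \<subseteq> game E \<gamma> UNIV"
proof
  fix v assume "v \<in> (\<Sum>S\<in>\<B>. (*\<^sub>R) (w S) ` game E \<gamma> S)"
  then obtain s where v: "v = sum s \<B>" and s: "\<And>S. S \<in> \<B> \<Longrightarrow> s S \<in> (*\<^sub>R) (w S) ` game E \<gamma> S"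
    by (auto simp: set_sum_alt)
  \<comment> \<open>The scaling already contained in the payoffs of \<open>S\<close>, so that
    \<open>w S * g S\<close> is the effective weight of a point of \<open>?Z\<close>.\<close>
  define g where "g S = (if S = UNIV then \<gamma> else 1)" for S :: "'n set"
  let ?Z = "lin_image E UNIV"
  have pos: "0 < \<gamma>" "real CARD('n) \<le> \<gamma>" "0 < real CARD('n)" using gamma by auto
  have w: "S \<noteq> {}" "0 < w S" if "S \<in> \<B>" for S
    using balanced that by (auto simp: balancing_weights_def)
  have "0 \<le> s S \<and> (\<exists>u\<in>?Z. s S \<le> (w S * g S) *\<^sub>R u)" if "S \<in> \<B>" for S
  proof -
    obtain z where z: "s S = w S *\<^sub>R z" "z \<in> game E \<gamma> S" using s[OF \<open>S \<in> \<B>\<close>] by blast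
    then obtain u where "0 \<le> z" "u \<in> ?Z" "z \<le> g S *\<^sub>R u"
      using game_dominated[OF w(1)[OF \<open>S \<in> \<B>\<close>]] unfolding g_def by blast
    then show ?thesis
      using w(2)[OF that] z(1) by (auto simp: less_eq_vec_def mult.assoc intro!: bexI[of _ u])
  qed
  then obtain u where s0: "\<And>S. S \<in> \<B> \<Longrightarrow> 0 \<le> s S"
    and u: "\<And>S. S \<in> \<B> \<Longrightarrow> u S \<in> ?Z" "\<And>S. S \<in> \<B> \<Longrightarrow> s S \<le> (w S * g S) *\<^sub>R u S"
    by metis
  \<comment> \<open>If \<open>S = UNIV\<close>, the two sides agree because \<open>card S\<close> is
    the number of agents; otherwise \<gamma> is at least that number and \<open>S\<close> has a
    member.\<close>
  have "w S * g S \<le> \<gamma> / real CARD('n) * (w S * real (card S))" if "S \<in> \<B>" for S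
  proof -
    have "1 \<le> real (card S)" using w(1)[OF that] by (simp add: Suc_le_eq card_gt_0_iff)
    then have "1 * 1 \<le> \<gamma> / real CARD('n) * real (card S)" using pos by (intro mult_mono) auto
    then have "g S \<le> \<gamma> / real CARD('n) * real (card S)" by (auto simp: g_def)
    from mult_left_mono[OF this less_imp_le[OF w(2)[OF that]]] show ?thesis
      by (simp add: mult_ac)
  qed
  then have "(\<Sum>S\<in>\<B>. w S * g S) \<le> \<gamma> / real CARD('n) * (\<Sum>S\<in>\<B>. w S * real (card S))"
    unfolding sum_distrib_left by (rule sum_mono)
  then have "(\<Sum>S\<in>\<B>. w S * g S) \<le> \<gamma>" by (simp add: balancing_weights_card[OF balanced])
  then have sum_le: "(\<Sum>S\<in>\<B>. w S * g S / \<gamma>) \<le> 1"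
    using pos(1) by (simp add: sum_divide_distrib[symmetric] divide_le_eq)
  note image = lin_image_props[OF endow_nonneg denom_pos[OF UNIV_not_empty]]
  \<comment> \<open>After division by \<gamma> the effective weights add up to at most 1, so
    \<open>p\<close> stays in \<open>?Z\<close>, and \<open>\<gamma> *\<^sub>R p\<close> is the
    weighted sum that bounds \<open>v\<close>.\<close>
  define p where "p = (\<Sum>S\<in>\<B>. (w S * g S / \<gamma>) *\<^sub>R u S)"
  have "p \<in> ?Z"
    unfolding p_def using image sum_le u(1) w(2) pos
    by (intro convex_sum_subunit) (auto simp: g_def less_imp_le)
  then obtain m where m: "m \<in> pareto_max ((*\<^sub>R) \<gamma> ` ?Z)" "\<gamma> *\<^sub>R p \<le> m"
    using pareto_max_dominates[OF compact_scaling[OF image(1)]] by blast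
  have "v \<le> (\<Sum>S\<in>\<B>. (w S * g S) *\<^sub>R u S)" unfolding v using u(2) by (rule sum_mono)
  also have "\<dots> = \<gamma> *\<^sub>R p" using pos(1) by (simp add: p_def scaleR_sum_right)
  also note m(2)
  finally have "0 \<le> m - v" by (simp add: less_eq_vec_def)
  moreover have "0 \<le> v" unfolding v using s0 by (rule sum_nonneg)
  \<comment> \<open>The vector subtracted from the Pareto maximal point \<open>m\<close> is
    \<open>m - v\<close>.\<close>
  ultimately have "v \<in> nonneg_down (pareto_max ((*\<^sub>R) \<gamma> ` ?Z))"
    using m(1) unfolding nonneg_down_def
    by (intro IntI CollectI exI[of _ m] exI[of _ "m - v"]) auto
  then show "v \<in> game E \<gamma> UNIV" by (simp add: game_def)
qed

end
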